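(* Let $m_0\ge1$ be an integer, $t_p=\frac{2\pi p}{m_0}$ for $p=0,1,\dots,m_0-1$, and $0<\alpha<\frac{2\pi}{m_0}$. Let $\mathbf{N}=(N_1,N_2)\in\mathbb{Z}^2$ and $f\in B_{\mathbf{N}}$. If $m_0>\frac{\mu(I^{\mathbf{N}})}{2}$, then $$f(t)=\sum_{p=0}^{m_0-1}\bigl(f(t_p)\,y_{1,\alpha}(t-t_p)+f(\alpha+t_p)\,y_{2,\alpha}(t-t_p)\bigr)\qquad\text{for all }t,$$ where $$y_{1,\alpha}(t)=\frac{\left(e^{\mathrm{i}m_0t}-1\right)\left(e^{\mathrm{i}(m_0\alpha+N_1t)}-e^{\mathrm{i}(m_0+N_1)t}\right)}{m_0\left(e^{\mathrm{i}t}-1\right)\left(e^{\mathrm{i}m_0\alpha}-1\right)},$$ $$y_{2,\alpha}(t)=\frac{e^{\mathrm{i}N_1t}\left(e^{\mathrm{i}m_0t}-1\right)\left(e^{\mathrm{i}m_0\alpha}-e^{\mathrm{i}m_0t}\right)e^{\mathrm{i}(1-m_0-N_1)\alpha}}{m_0\left(e^{\mathrm{i}m_0\alpha}-1\right)\left(e^{\mathrm{i}\alpha}-e^{\mathrm{i}t}\right)} .$$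
   Context: Here $\mathrm{i}$ is the imaginary unit. For $\mathbf{N}=(N_1,N_2)\in\mathbb{Z}^2$ with $N_1\le N_2$, $I^{\mathbf{N}}=\{n\in\mathbb{Z}: N_1\le n\le N_2\}$, $\mu(I^{\mathbf{N}})=N_2-N_1+1$ (the bandwidth) is its cardinality, and $B_{\mathbf{N}}$ is the set of all functions of the form $f(t)=\sum_{n\in I^{\mathbf{N}}}a(n)e^{\mathrm{i}nt}$ with $a(n)\in\mathbb{C}$. The functions $y_{1,\alpha}$ and $y_{2,\alpha}$ are trigonometric polynomials; at points where the displayed denominators vanish (a removable singularity) they are understood as extended by continuity. *)

theory Defs
  imports Complex_Main
begin

definition freq_interval :: "int \<Rightarrow> int \<Rightarrow> int set" where
  "freq_interval N1 N2 = {N1..N2}"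

definition bandwidth :: "int \<Rightarrow> int \<Rightarrow> nat" where
  "bandwidth N1 N2 = card (freq_interval N1 N2)"

definition bandlimited :: "int \<Rightarrow> int \<Rightarrow> (real \<Rightarrow> complex) set" where
  "bandlimited N1 N2 =
     {f. \<exists>a :: int \<Rightarrow> complex. \<forall>t. f t =
           (\<Sum>n\<in>freq_interval N1 N2. a n * exp (\<i> * of_int n * of_real t))}"

definition node :: "nat \<Rightarrow> nat \<Rightarrow> real" where
  "node m p = 2 * pi * real p / real m"

text \<open>
  The quotient of two functions, extended by continuity to the zeros of the denominator:
  there its value is the limit over the punctured neighbourhood of the point, rather than
  the value 0 given by the convention \<open>x / 0 = 0\<close>.
\<close>

definition quotient_ext :: "(real \<Rightarrow> complex) \<Rightarrow> (real \<Rightarrow> complex) \<Rightarrow> real \<Rightarrow> complex" where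
  "quotient_ext g h t = (if h t = 0 then Lim (at t) (\<lambda>s. g s / h s) else g t / h t)"

definition y1 :: "nat \<Rightarrow> int \<Rightarrow> real \<Rightarrow> real \<Rightarrow> complex" where
  "y1 m N1 \<alpha> = quotient_ext
     (\<lambda>t. (exp (\<i> * of_nat m * of_real t) - 1)
         * (exp (\<i> * (of_nat m * of_real \<alpha> + of_int N1 * of_real t))
            - exp (\<i> * (of_nat m + of_int N1) * of_real t)))
     (\<lambda>t. of_nat m * (exp (\<i> * of_real t) - 1) * (exp (\<i> * of_nat m * of_real \<alpha>) - 1))"

definition y2 :: "nat \<Rightarrow> int \<Rightarrow> real \<Rightarrow> real \<Rightarrow> complex" where
  "y2 m N1 \<alpha> = quotient_ext
     (\<lambda>t. exp (\<i> * of_int N1 * of_real t)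
         * (exp (\<i> * of_nat m * of_real t) - 1)
         * (exp (\<i> * of_nat m * of_real \<alpha>) - exp (\<i> * of_nat m * of_real t))
         * exp (\<i> * (1 - of_nat m - of_int N1) * of_real \<alpha>))
     (\<lambda>t. of_nat m * (exp (\<i> * of_nat m * of_real \<alpha>) - 1)
         * (exp (\<i> * of_real \<alpha>) - exp (\<i> * of_real t)))"

end

theory Submission
  imports Defs
begin

text \<open>
  Up to a factor depending only on \<open>exp (\<i> m t)\<close>, which is unchanged by shifts through the nodes,
  both \<open>y\<^sub>1(t)\<close> and \<open>y\<^sub>2(t + \<alpha>)\<close> are the Dirichlet kernel of the \<open>m\<close> frequencies
  \<open>N\<^sub>1, \<dots>, N\<^sub>1 + m - 1\<close>. Sampling \<open>exp (\<i> n t)\<close> at the \<open>m\<close> nodes against this kernel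
  replaces \<open>n\<close> by its residue modulo \<open>m\<close> in that window. As the bandwidth is less than \<open>2 m\<close>,
  \<open>n\<close> is this residue or exceeds it by \<open>m\<close>, and the factors combine the two aliased
  copies so that either case is reproduced.
\<close>

section \<open>Zeros of the denominators and removable singularities\<close>

lemma cis_eq_1_iff: "cis x = 1 \<longleftrightarrow> (\<exists>k::int. x = 2 * pi * of_int k)"
proof
  assume "cis x = 1"
  then have "cos x = 1" by (simp add: complex_eq_iff)
  then show "\<exists>k::int. x = 2 * pi * of_int k" by (auto simp: cos_one_2pi_int)
qed (auto simp: cis_multiple_2pi)

lemma cis_neq_1_of_small:
  assumes "x \<noteq> 0" and "\<bar>x\<bar> < 2 * pi"
  shows "cis x \<noteq> 1"
proof
  assume "cis x = 1"
  then obtain k :: int where k: "x = 2 * pi * of_int k" by (auto simp: cis_eq_1_iff)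
  with assms have "k \<noteq> 0" "\<bar>real_of_int k\<bar> < 1" by (auto simp: abs_mult)
  then show False by linarith
qed

text \<open>Zeros of \<open>cis s - cis b\<close> are isolated: two distinct ones differ by a
  nonzero multiple of \<open>2 * pi\<close>. It is applied to the denominators of \<open>y1\<close>
  (with \<open>b = 0\<close>) and of \<open>y2\<close> (with \<open>b = \<alpha>\<close>).\<close>

lemma eventually_cis_neq:
  assumes "cis t = cis b"
  shows "\<forall>\<^sub>F s in at t. cis s \<noteq> cis b"
  unfolding eventually_at
proof (intro exI[of _ "2 * pi"] conjI ballI impI)
  fix s assume s: "s \<noteq> t \<and> dist s t < 2 * pi"
  then have "cis (s - t) \<noteq> 1" by (intro cis_neq_1_of_small) (auto simp: dist_real_def)
  then show "cis s \<noteq> cis b" by (auto simp: cis_divide[symmetric] assms)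
qed simp

text \<open>Off the zeros of \<open>h\<close> the factorization yields the quotient directly; at an
  isolated zero the limit is forced by continuity of \<open>q\<close>. Computing \<open>y1\<close>
  and \<open>y2\<close> thus reduces to identities free of division by a vanishing term.\<close>

lemma quotient_ext_eqI:
  assumes factor: "\<And>s. g s = q s * h s"
    and nz: "h t = 0 \<Longrightarrow> \<forall>\<^sub>F s in at t. h s \<noteq> 0"
    and cont: "isCont q t"
  shows "quotient_ext g h t = q t"
proof (cases "h t = 0")
  case True
  have "\<forall>\<^sub>F s in at t. q s = g s / h s"
    using nz[OF True] by eventually_elim (simp add: factor)
  moreover have "(q \<longlongrightarrow> q t) (at t)" using cont by (simp add: isCont_def)
  ultimately have "((\<lambda>s. g s / h s) \<longlongrightarrow> q t) (at t)"
    using tendsto_cong[of q "\<lambda>s. g s / h s"] by simp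
  then have "Lim (at t) (\<lambda>s. g s / h s) = q t" by (intro tendsto_Lim) simp_all
  then show ?thesis using True by (simp add: quotient_ext_def)
qed (simp add: quotient_ext_def factor)

section \<open>The Dirichlet kernel and its relation to \<open>y1\<close> and
  \<open>y2\<close>\<close>

definition dirichlet_kernel :: "nat \<Rightarrow> int \<Rightarrow> real \<Rightarrow> complex" where
  "dirichlet_kernel m N t = (\<Sum>k<m. cis ((of_int N + real k) * t))"

lemma isCont_cis: "isCont f t \<Longrightarrow> isCont (\<lambda>s. cis (f s)) t"
  unfolding isCont_def by (rule tendsto_cis)

text \<open>The kernel is defined as a finite sum, not as a quotient, so it is continuous at
  multiples of \<open>2 * pi\<close> too; this gives the values of \<open>y1\<close> and
  \<open>y2\<close> at their removable singularities.\<close>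

lemma isCont_dirichlet_kernel: "isCont (dirichlet_kernel m N) t"
  unfolding dirichlet_kernel_def[abs_def] by (simp add: isCont_cis)

text \<open>A geometric sum with ratio \<open>cis t\<close>, kept in product form so that it also
  holds where \<open>cis t = 1\<close>.\<close>

lemma dirichlet_kernel_mult:
  "dirichlet_kernel m N t * (cis t - 1) = cis (of_int N * t) * (cis (real m * t) - 1)"
proof -
  have "dirichlet_kernel m N t = cis (of_int N * t) * (\<Sum>k<m. cis t ^ k)"
    by (simp add: dirichlet_kernel_def sum_distrib_left DeMoivre cis_mult distrib_right)
  moreover have "(cis t - 1) * (\<Sum>k<m. cis t ^ k) = cis (real m * t) - 1"
    using power_diff_1_eq[of "cis t" m] by (simp only: DeMoivre)
  ultimately show ?thesis by (simp add: mult_ac)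
qed

text \<open>Pulling \<open>cis (of_int N * t)\<close> out of the second factor of the numerator
  leaves a closed geometric sum times \<open>cis (real m * \<alpha>) - cis (real m * t)\<close>. By
  \<open>W\<close> the denominator vanishes only where \<open>cis t = 1\<close>.\<close>

lemma y1_eq_dirichlet_kernel:
  assumes "m > 0" and W: "cis (real m * \<alpha>) \<noteq> 1"
  shows "y1 m N \<alpha> t = dirichlet_kernel m N t * (cis (real m * \<alpha>) - cis (real m * t))
           / (of_nat m * (cis (real m * \<alpha>) - 1))"
  unfolding y1_def
proof (rule quotient_ext_eqI)
  fix s
  let ?W = "cis (real m * \<alpha>)" and ?Z = "cis (real m * s)"
  have e: "exp (\<i> * of_nat m * of_real s) = ?Z"
    "exp (\<i> * of_nat m * of_real \<alpha>) = ?W"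
    "exp (\<i> * of_real s) = cis s"
    "exp (\<i> * (of_nat m * of_real \<alpha> + of_int N * of_real s)) = ?W * cis (of_int N * s)"
    "exp (\<i> * (of_nat m + of_int N) * of_real s) = ?Z * cis (of_int N * s)"
    by (simp_all add: cis_conv_exp mult_ac exp_add[symmetric] ring_distribs add.commute)
  have "(?Z - 1) * (?W * cis (of_int N * s) - ?Z * cis (of_int N * s))
      = (cis (of_int N * s) * (?Z - 1)) * (?W - ?Z)"
    by (simp add: algebra_simps)
  also have "\<dots> = dirichlet_kernel m N s * (cis s - 1) * (?W - ?Z)"
    by (simp only: dirichlet_kernel_mult)
  finally show "(exp (\<i> * of_nat m * of_real s) - 1)
         * (exp (\<i> * (of_nat m * of_real \<alpha> + of_int N * of_real s))
            - exp (\<i> * (of_nat m + of_int N) * of_real s)) =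
      dirichlet_kernel m N s * (?W - ?Z) / (of_nat m * (?W - 1)) *
      (of_nat m * (exp (\<i> * of_real s) - 1) * (exp (\<i> * of_nat m * of_real \<alpha>) - 1))"
    unfolding e using assms by simp
next
  assume "of_nat m * (exp (\<i> * of_real t) - 1) * (exp (\<i> * of_nat m * of_real \<alpha>) - 1) = 0"
  with assms have "cis t = cis 0" by (simp add: cis_conv_exp mult_ac)
  then have "\<forall>\<^sub>F s in at t. cis s \<noteq> cis 0" by (rule eventually_cis_neq)
  then show "\<forall>\<^sub>F s in at t.
      of_nat m * (exp (\<i> * of_real s) - 1) * (exp (\<i> * of_nat m * of_real \<alpha>) - 1) \<noteq> 0"
    by eventually_elim (use assms in \<open>simp add: cis_conv_exp mult_ac\<close>)
next
  show "isCont (\<lambda>s. dirichlet_kernel m N s * (cis (real m * \<alpha>) - cis (real m * s))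
           / (of_nat m * (cis (real m * \<alpha>) - 1))) t"
    using assms by (simp add: isCont_dirichlet_kernel isCont_cis)
qed

text \<open>Here the other factor of the numerator is absorbed:
  \<open>cis (real m * \<alpha>) - cis (real m * t)\<close> over \<open>cis \<alpha> - cis t\<close>
  is a geometric sum in \<open>cis (t - \<alpha>)\<close> up to a phase, and
  \<open>cis (real m * t) - 1\<close> remains.\<close>

lemma y2_eq_dirichlet_kernel:
  assumes "m > 0" and W: "cis (real m * \<alpha>) \<noteq> 1"
  shows "y2 m N \<alpha> t = dirichlet_kernel m N (t - \<alpha>) * (cis (real m * t) - 1)
           / (of_nat m * (cis (real m * \<alpha>) - 1))"
  unfolding y2_def
proof (rule quotient_ext_eqI)
  fix s
  let ?W = "cis (real m * \<alpha>)" and ?Z = "cis (real m * s)"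
  let ?D = "dirichlet_kernel m N (s - \<alpha>)"
  have e: "exp (\<i> * of_nat m * of_real s) = ?Z"
    "exp (\<i> * of_nat m * of_real \<alpha>) = ?W"
    "exp (\<i> * of_real s) = cis s"
    "exp (\<i> * of_real \<alpha>) = cis \<alpha>"
    "exp (\<i> * of_int N * of_real s) = cis (of_int N * s)"
    "exp (\<i> * (1 - of_nat m - of_int N) * of_real \<alpha>) = cis ((1 - real m - of_int N) * \<alpha>)"
    by (simp_all add: cis_conv_exp mult_ac)
  have "?D * (cis \<alpha> - cis s) = - cis \<alpha> * (?D * (cis (s - \<alpha>) - 1))"
    by (simp add: cis_divide[symmetric] field_simps)
  also have "\<dots> = cis \<alpha> * cis (of_int N * (s - \<alpha>)) * (1 - cis (real m * (s - \<alpha>)))"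
    unfolding dirichlet_kernel_mult by (simp add: algebra_simps)
  \<comment> \<open>Since \<open>1 - cis (real m * (s - \<alpha>))\<close> is
    \<open>cis (- real m * \<alpha>) * (?W - ?Z)\<close>, the phases in \<open>\<alpha>\<close>
    collect to the exponent \<open>1 - m - N\<close> occurring in \<open>y2\<close>.\<close>
  also have "\<dots> = cis (of_int N * s) * (?W - ?Z) * cis ((1 - real m - of_int N) * \<alpha>)"
    by (simp add: algebra_simps cis_mult)
  finally have D: "?D * (cis \<alpha> - cis s)
      = cis (of_int N * s) * (?W - ?Z) * cis ((1 - real m - of_int N) * \<alpha>)" .
  have "?D * (?Z - 1) / (of_nat m * (?W - 1)) * (of_nat m * (?W - 1) * (cis \<alpha> - cis s))
      = (?Z - 1) * (?D * (cis \<alpha> - cis s))"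
    using assms by simp
  then show "exp (\<i> * of_int N * of_real s)
         * (exp (\<i> * of_nat m * of_real s) - 1)
         * (exp (\<i> * of_nat m * of_real \<alpha>) - exp (\<i> * of_nat m * of_real s))
         * exp (\<i> * (1 - of_nat m - of_int N) * of_real \<alpha>) =
      ?D * (?Z - 1) / (of_nat m * (?W - 1)) *
      (of_nat m * (exp (\<i> * of_nat m * of_real \<alpha>) - 1)
         * (exp (\<i> * of_real \<alpha>) - exp (\<i> * of_real s)))"
    unfolding e D by (simp add: mult_ac)
next
  assume "of_nat m * (exp (\<i> * of_nat m * of_real \<alpha>) - 1)
         * (exp (\<i> * of_real \<alpha>) - exp (\<i> * of_real t)) = 0"
  with assms have "cis t = cis \<alpha>" by (simp add: cis_conv_exp mult_ac)
  then have "\<forall>\<^sub>F s in at t. cis s \<noteq> cis \<alpha>" by (rule eventually_cis_neq)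
  then show "\<forall>\<^sub>F s in at t. of_nat m * (exp (\<i> * of_nat m * of_real \<alpha>) - 1)
         * (exp (\<i> * of_real \<alpha>) - exp (\<i> * of_real s)) \<noteq> 0"
    by eventually_elim (use assms in \<open>simp add: cis_conv_exp mult_ac\<close>)
next
  have "isCont (\<lambda>s. dirichlet_kernel m N (s - \<alpha>)) t"
    by (rule isCont_o2[OF _ isCont_dirichlet_kernel]) simp
  then show "isCont (\<lambda>s. dirichlet_kernel m N (s - \<alpha>) * (cis (real m * s) - 1)
           / (of_nat m * (cis (real m * \<alpha>) - 1))) t"
    using assms by (simp add: isCont_cis)
qed

section \<open>Orthogonality on the nodes and aliasing\<close>

lemma sum_cis_node:
  fixes d :: int
  assumes "m > 0"
  shows "(\<Sum>p<m. cis (of_int d * node m p)) = (if int m dvd d then of_nat m else 0)"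
proof -
  define c where "c = cis (2 * pi * of_int d / real m)"
  have c1: "c = 1 \<longleftrightarrow> int m dvd d"
  proof -
    have "c = 1 \<longleftrightarrow> (\<exists>k::int. real_of_int d = of_int (int m * k))"
      using assms by (simp add: c_def cis_eq_1_iff field_simps)
    also have "\<dots> \<longleftrightarrow> int m dvd d" by (simp only: of_int_eq_iff dvd_def)
    finally show ?thesis .
  qed
  \<comment> \<open>The terms are powers of the \<open>m\<close>-th root of unity \<open>c\<close>,
    so their geometric sum vanishes unless \<open>c = 1\<close>.\<close>
  have "c ^ m = 1" using assms by (simp add: c_def DeMoivre cis_multiple_2pi)
  moreover have "cis (of_int d * node m p) = c ^ p" for p
    by (simp add: c_def node_def DeMoivre mult_ac)
  ultimately show ?thesis using c1 by (simp add: sum_gp_strict)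
qed

text \<open>Expanding the kernel and summing over the nodes first, orthogonality keeps only the
  frequency of the window that is congruent to \<open>n\<close> modulo \<open>m\<close>.\<close>

lemma sum_nodes_dirichlet_kernel:
  fixes n N :: int
  assumes "m > 0"
  shows "(\<Sum>p<m. cis (of_int n * node m p) * dirichlet_kernel m N (t - node m p))
       = of_nat m * cis (of_int (N + (n - N) mod int m) * t)"
proof -
  define r where "r = nat ((n - N) mod int m)"
  have r: "r < m" "int r = (n - N) mod int m"
    using assms by (simp_all add: r_def nat_less_iff)
  have dvd_iff: "int m dvd n - N - int k \<longleftrightarrow> k = r" if "k < m" for k
  proof -
    have "int m dvd n - N - int k \<longleftrightarrow> (n - N) mod int m = int k mod int m"
      by (simp add: mod_eq_dvd_iff)
    \<comment> \<open>A window of \<open>m\<close> consecutive integers meets each residue class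
      exactly once.\<close>
    also have "\<dots> \<longleftrightarrow> k = r" using that r by auto
    finally show ?thesis .
  qed
  have "(\<Sum>p<m. cis (of_int n * node m p) * dirichlet_kernel m N (t - node m p))
      = (\<Sum>p<m. \<Sum>k<m. cis ((of_int N + real k) * t) * cis (of_int (n - N - int k) * node m p))"
    by (simp add: dirichlet_kernel_def sum_distrib_left cis_mult algebra_simps)
  also have "\<dots> = (\<Sum>k<m. \<Sum>p<m. cis ((of_int N + real k) * t) * cis (of_int (n - N - int k) * node m p))"
    by (rule sum.swap)
  also have "\<dots> = (\<Sum>k<m. cis ((of_int N + real k) * t) * (if int m dvd n - N - int k then of_nat m else 0))"
    by (simp only: sum_distrib_left[symmetric] sum_cis_node[OF assms])
  also have "\<dots> = (\<Sum>k<m. if k = r then cis ((of_int N + real k) * t) * of_nat m else 0)"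
    by (intro sum.cong) (auto simp: dvd_iff)
  also have "\<dots> = of_nat m * cis ((of_int N + real r) * t)"
    using r by simp
  also have "of_int N + real r = of_int (N + (n - N) mod int m)"
    by (simp add: r(2)[symmetric])
  finally show ?thesis .
qed

text \<open>\<open>real m * node m p\<close> is a multiple of \<open>2 * pi\<close>. Hence the
  factors multiplying the kernels in \<open>y1\<close> and \<open>y2\<close> do not depend on
  \<open>p\<close> and leave the sums over the nodes.\<close>

lemma cis_shift_node:
  assumes "m > 0"
  shows "cis (real m * (t - node m p)) = cis (real m * t)"
proof -
  have "cis (real m * node m p) = 1"
    using assms cis_multiple_2pi[of "real p"] by (simp add: node_def)
  then show ?thesis by (simp add: right_diff_distrib cis_divide[symmetric])
qed

text \<open>Each of the two node sums returns the alias \<open>l\<close> of \<open>n\<close> in the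
  window. The samples shifted by \<open>\<alpha>\<close> carry the extra phase
  \<open>cis (of_int (n - l) * \<alpha>)\<close>, which tells \<open>n = l\<close> from
  \<open>n = l + m\<close>.\<close>

lemma sampling_formula_cis:
  fixes n N :: int
  assumes m: "m > 0" and W: "cis (real m * \<alpha>) \<noteq> 1"
    and n: "N \<le> n" "n < N + 2 * int m"
  shows "(\<Sum>p<m. cis (of_int n * node m p) * y1 m N \<alpha> (t - node m p)
            + cis (of_int n * (\<alpha> + node m p)) * y2 m N \<alpha> (t - node m p)) = cis (of_int n * t)"
proof -
  define W where "W = cis (real m * \<alpha>)"
  define Z where "Z = cis (real m * t)"
  define l where "l = N + (n - N) mod int m"
  have l: "n = l \<or> n = l + int m"
  proof -
    have "n = l + int m * ((n - N) div int m)"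
      using mult_div_mod_eq[of "int m" "n - N"] by (simp add: l_def)
    \<comment> \<open>The bound \<open>n < N + 2 * int m\<close> enters here: only two aliases are
      possible.\<close>
    moreover have "(n - N) div int m = 0 \<or> (n - N) div int m = 1"
    proof (cases "n < N + int m")
      case True
      then show ?thesis using n by (simp add: div_pos_pos_trivial)
    next
      case False
      then have "(n - N - int m) div int m = 0" using n by (simp add: div_pos_pos_trivial)
      then show ?thesis using m div_add_self2[of "int m" "n - N - int m"] by simp
    qed
    ultimately show ?thesis by auto
  qed
  let ?D = "dirichlet_kernel m N"
  let ?c = "of_nat m * (W - 1)"
  have "(\<Sum>p<m. cis (of_int n * node m p) * y1 m N \<alpha> (t - node m p)
            + cis (of_int n * (\<alpha> + node m p)) * y2 m N \<alpha> (t - node m p))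
      = (\<Sum>p<m. cis (of_int n * node m p) * ?D (t - node m p) * ((W - Z) / ?c)
            + cis (of_int n * node m p) * ?D (t - \<alpha> - node m p) * (cis (of_int n * \<alpha>) * (Z - 1) / ?c))"
    using assms
    by (intro sum.cong) (simp_all add: y1_eq_dirichlet_kernel y2_eq_dirichlet_kernel cis_shift_node
        W_def Z_def distrib_left cis_mult[symmetric] diff_right_commute mult_ac)
  also have "\<dots> = of_nat m * cis (of_int l * t) * ((W - Z) / ?c)
            + of_nat m * cis (of_int l * (t - \<alpha>)) * (cis (of_int n * \<alpha>) * (Z - 1) / ?c)"
    by (simp only: sum.distrib sum_distrib_right[symmetric] sum_nodes_dirichlet_kernel[OF m] l_def)
  also have "\<dots> = (cis (of_int l * t) * (W - Z)
            + cis (of_int l * (t - \<alpha>)) * cis (of_int n * \<alpha>) * (Z - 1)) / (W - 1)"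
    using m by (simp add: add_divide_distrib mult_ac)
  also have "cis (of_int l * (t - \<alpha>)) * cis (of_int n * \<alpha>) = cis (of_int l * t) * cis (of_int (n - l) * \<alpha>)"
    by (simp add: cis_mult algebra_simps)
  also have "(cis (of_int l * t) * (W - Z) + cis (of_int l * t) * cis (of_int (n - l) * \<alpha>) * (Z - 1)) / (W - 1)
      = cis (of_int n * t)"
    using l
  proof
    assume "n = l"
    have "W - Z + (Z - 1) = W - 1" by simp
    then show ?thesis
      using W \<open>n = l\<close> by (simp add: W_def[symmetric] distrib_left[symmetric])
  next
    \<comment> \<open>Now the phase is \<open>W\<close>, and
      \<open>W - Z + W * (Z - 1) = Z * (W - 1)\<close> raises the frequency from \<open>l\<close> to
      \<open>n\<close>.\<close>
    assume nl: "n = l + int m"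
    then have "cis (of_int n * t) = cis (of_int l * t) * Z" "cis (of_int (n - l) * \<alpha>) = W"
      by (simp_all add: Z_def W_def cis_mult distrib_right)
    then show ?thesis
      using W by (simp add: W_def[symmetric] divide_simps) (simp add: algebra_simps)
  qed
  finally show ?thesis .
qed

theorem mainTheorem4:
  fixes m0 :: nat and \<alpha> :: real and N1 N2 :: int and f :: "real \<Rightarrow> complex"
  assumes "m0 \<ge> 1"
    and "0 < \<alpha>" and "\<alpha> < 2 * pi / real m0"
    and "N1 \<le> N2"
    and "f \<in> bandlimited N1 N2"
    and "real m0 > real (bandwidth N1 N2) / 2"
  shows "\<forall>t. f t = (\<Sum>p = 0..m0 - 1.
           f (node m0 p) * y1 m0 N1 \<alpha> (t - node m0 p)
           + f (\<alpha> + node m0 p) * y2 m0 N1 \<alpha> (t - node m0 p))"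
proof
  fix t
  have m: "m0 > 0" using assms(1) by simp
  \<comment> \<open>The range of \<open>\<alpha>\<close> says that \<open>real m0 * \<alpha>\<close>
    lies strictly between \<open>0\<close> and \<open>2 * pi\<close>.\<close>
  have W: "cis (real m0 * \<alpha>) \<noteq> 1"
    using assms(2,3) m by (intro cis_neq_1_of_small) (auto simp: abs_mult field_simps)
  obtain a where a: "\<And>t. f t = (\<Sum>n\<in>{N1..N2}. a n * cis (of_int n * t))"
    using assms(5) by (auto simp: bandlimited_def freq_interval_def cis_conv_exp mult_ac)
  have "N2 < N1 + 2 * int m0"
    using assms(4,6) by (simp add: bandwidth_def freq_interval_def)
  then have s: "(\<Sum>p<m0. cis (of_int n * node m0 p) * y1 m0 N1 \<alpha> (t - node m0 p)
      + cis (of_int n * (\<alpha> + node m0 p)) * y2 m0 N1 \<alpha> (t - node m0 p)) = cis (of_int n * t)"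
    if "n \<in> {N1..N2}" for n
    using that by (intro sampling_formula_cis m W) auto
  \<comment> \<open>The formula is linear in the sampled function, so it passes from exponentials to
    \<open>f\<close> by exchanging the two finite sums.\<close>
  have "f t = (\<Sum>n\<in>{N1..N2}. a n * (\<Sum>p<m0. cis (of_int n * node m0 p) * y1 m0 N1 \<alpha> (t - node m0 p)
      + cis (of_int n * (\<alpha> + node m0 p)) * y2 m0 N1 \<alpha> (t - node m0 p)))"
    unfolding a by (intro sum.cong refl) (simp only: s)
  also have "\<dots> = (\<Sum>p<m0. \<Sum>n\<in>{N1..N2}. a n * (cis (of_int n * node m0 p) * y1 m0 N1 \<alpha> (t - node m0 p)
      + cis (of_int n * (\<alpha> + node m0 p)) * y2 m0 N1 \<alpha> (t - node m0 p)))"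
    unfolding sum_distrib_left by (rule sum.swap)
  also have "\<dots> = (\<Sum>p<m0. f (node m0 p) * y1 m0 N1 \<alpha> (t - node m0 p)
           + f (\<alpha> + node m0 p) * y2 m0 N1 \<alpha> (t - node m0 p))"
    by (simp add: a sum_distrib_right sum.distrib distrib_left mult.assoc)
  \<comment> \<open>The subtraction is on naturals; \<open>m0 > 0\<close> keeps it from
    truncating.\<close>
  also have "{..<m0} = {0..m0 - 1}" using m by auto
  finally show "f t = (\<Sum>p = 0..m0 - 1.
           f (node m0 p) * y1 m0 N1 \<alpha> (t - node m0 p)
           + f (\<alpha> + node m0 p) * y2 m0 N1 \<alpha> (t - node m0 p))" .
qed

end
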